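(* Let $K\ge 2$ and $L\ge 0$ be integers with $L\le B_K$, where $B_K=\frac{K-\sqrt{3K-2}}{2}$ if $K$ is even and $B_K=\frac{K-\sqrt{3K}}{2}$ if $K$ is odd. Let $\bar\xi^*$ be a symmetric invariant design on $\mathcal{X}_{L,K-L}$ which is supported on at most three symmetric orbits in $\mathcal{X}_{L,K-L}$ and satisfies $\mathbf{M}(\bar\xi^* )=\mathbf{I}_p$. Then $\bar\xi^*$ is $D$-optimal on $\mathcal{X}_{L,K-L}$.
   Context: Model: for $\bm{x}=(x_1,\dots,x_K)^\top\in\{-1,+1\}^K$ let $\bm{f}(\bm{x})=(1,\,x_1,\dots,x_K,\,x_1x_2,\dots,x_{K-1}x_K)^\top\in\mathbb{R}^p$ (constant, main effects $x_k$, and all two-factor interactions $x_jx_k$, $j<k$), so $p=1+K(K+1)/2$. A design $\xi$ is a probability measure on $\{-1,+1\}^K$ (finitely many points $\bm{x}_i$ with weights $w_i\ge 0$, $\sum_i w_i=1$); its information matrix is $\mathbf{M}(\xi)=\sum_i w_i\,\bm{f}(\bm{x}_i)\bm{f}(\bm{x}_i)^\top$. A design on a region $\mathcal{X}\subseteq\{-1,+1\}^K$ is a design whose support is contained in $\mathcal{X}$. A design on $\mathcal{X}$ is $D$-optimal on $\mathcal{X}$ if it maximizes $\det\mathbf{M}(\xi)$ among all designs $\xi$ on $\mathcal{X}$. Let $d(\bm{x})$ be the number of entries of $\bm{x}$ equal to $+1$, and $\mathcal{X}_{L,U}=\{\bm{x}\in\{-1,+1\}^K:\ L\le d(\bm{x})\le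 U\}$. For $0\le k\le K$ let $\mathcal{O}_k=\{\bm{x}: d(\bm{x})=k\}$ and let $\bar\xi_k$ be the uniform design on $\mathcal{O}_k$. For $0\le k\le K/2$ the symmetric orbit is $\tilde{\mathcal{O}}_k=\mathcal{O}_k\cup\mathcal{O}_{K-k}$. A symmetric invariant design is one of the form $\bar\xi=\sum_{k=0}^K\bar w_k\bar\xi_k$ with $\bar w_k\ge0$, $\sum_k\bar w_k=1$ and $\bar w_k=\bar w_{K-k}$ for all $k$; it is supported on the symmetric orbits $\tilde{\mathcal{O}}_k$ with $\bar w_k>0$. *)

theory Defs
  imports
    "HOL-Probability.Probability_Mass_Function"
    "Jordan_Normal_Form.Determinant"
begin

unbundle no vec_syntax

text \<open>Points of the cube and regression vectors are vectors in the sense of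
  \<^theory>\<open>Jordan_Normal_Form.Matrix\<close>, indexed from \<open>0\<close>.\<close>

definition cube :: "nat \<Rightarrow> real vec set" where
  "cube K = {x \<in> carrier_vec K. \<forall>i<K. x $ i \<in> {-1, 1}}"

definition num_params :: "nat \<Rightarrow> nat" where
  "num_params K = 1 + K * (K + 1) div 2"

definition regression :: "nat \<Rightarrow> real vec \<Rightarrow> real vec" where
  "regression K x = vec_of_list
     ([1] @ [x $ k. k \<leftarrow> [0..<K]] @ [x $ j * x $ k. j \<leftarrow> [0..<K], k \<leftarrow> [Suc j..<K]])"

lemma dim_regression [simp]: "dim_vec (regression K x) = num_params K"
proof -
  have "(\<Sum>j<K. K - Suc j) = (\<Sum>j<K. j)"
    by (rule sum.nat_diff_reindex)
  moreover have "n + (\<Sum>j<n. j) = n * (n + 1) div 2" for n :: nat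
    by (induction n) auto
  note this[of K]
  ultimately show ?thesis
    by (simp add: regression_def num_params_def length_concat o_def
        interv_sum_list_conv_sum_set_nat lessThan_atLeast0)
qed

definition design_on :: "nat \<Rightarrow> real vec set \<Rightarrow> real vec pmf \<Rightarrow> bool" where
  "design_on K X \<xi> \<longleftrightarrow> X \<subseteq> cube K \<and> set_pmf \<xi> \<subseteq> X"

definition info_mat :: "nat \<Rightarrow> real vec pmf \<Rightarrow> real mat" where
  "info_mat K \<xi> = mat (num_params K) (num_params K)
     (\<lambda>(i, j). \<Sum>x\<in>cube K. pmf \<xi> x * (regression K x $ i * regression K x $ j))"

definition D_optimal_on :: "nat \<Rightarrow> real vec set \<Rightarrow> real vec pmf \<Rightarrow> bool" where
  "D_optimal_on K X \<xi> \<longleftrightarrow> design_on K X \<xi> \<and>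
     (\<forall>\<eta>. design_on K X \<eta> \<longrightarrow> Determinant.det (info_mat K \<eta>) \<le> Determinant.det (info_mat K \<xi>))"

definition num_plus :: "real vec \<Rightarrow> nat" where
  "num_plus x = card {i. i < dim_vec x \<and> x $ i = 1}"

lemma finite_cube: "finite (cube K)"
proof -
  have "cube K \<subseteq> vec_of_list ` {xs. set xs \<subseteq> {-1, 1} \<and> length xs = K}"
  proof
    fix x assume "x \<in> cube K"
    then have "x = vec_of_list (list_of_vec x)" "length (list_of_vec x) = K"
      "set (list_of_vec x) \<subseteq> {-1, 1}"
      by (auto simp: cube_def vec_list in_set_conv_nth list_of_vec_index)
    then show "x \<in> vec_of_list ` {xs. set xs \<subseteq> {-1, 1} \<and> length xs = K}"
      by blast
  qed
  then show ?thesis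
    by (rule finite_subset) (simp add: finite_lists_length_eq)
qed

definition region :: "nat \<Rightarrow> nat \<Rightarrow> nat \<Rightarrow> real vec set" where
  "region K L U = {x \<in> cube K. L \<le> num_plus x \<and> num_plus x \<le> U}"

definition orbit :: "nat \<Rightarrow> nat \<Rightarrow> real vec set" where
  "orbit K k = {x \<in> cube K. num_plus x = k}"

lemma orbit_nonempty: "k \<le> K \<Longrightarrow> orbit K k \<noteq> {}"
proof -
  assume k: "k \<le> K"
  let ?x = "vec K (\<lambda>i. if i < k then 1 else - 1 :: real)"
  have "{i. i < K \<and> ?x $ i = 1} = {..<k}"
    using k by (auto split: if_splits)
  then have "?x \<in> orbit K k"
    by (simp add: orbit_def cube_def num_plus_def)
  then show ?thesis by blast
qed

definition orbit_design :: "nat \<Rightarrow> nat \<Rightarrow> real vec pmf" where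
  "orbit_design K k = pmf_of_set (orbit K k)"

lemma set_orbit_design: "k \<le> K \<Longrightarrow> set_pmf (orbit_design K k) = orbit K k"
  unfolding orbit_design_def
  by (intro set_pmf_of_set orbit_nonempty) (auto simp: orbit_def intro: finite_subset[OF _ finite_cube])

definition symmetric_orbit :: "nat \<Rightarrow> nat \<Rightarrow> real vec set" where
  "symmetric_orbit K k = orbit K k \<union> orbit K (K - k)"

text \<open>The values \<open>w k\<close> for \<open>k > K\<close> are irrelevant.\<close>

definition symmetric_invariant :: "nat \<Rightarrow> (nat \<Rightarrow> real) \<Rightarrow> real vec pmf \<Rightarrow> bool" where
  "symmetric_invariant K w \<xi> \<longleftrightarrow>
     (\<forall>k\<le>K. 0 \<le> w k) \<and> (\<Sum>k\<le>K. w k) = 1 \<and> (\<forall>k\<le>K. w k = w (K - k)) \<and>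
     (\<forall>x. pmf \<xi> x = (\<Sum>k\<le>K. w k * pmf (orbit_design K k) x))"

definition supporting_orbits :: "nat \<Rightarrow> (nat \<Rightarrow> real) \<Rightarrow> real vec set set" where
  "supporting_orbits K w = {symmetric_orbit K k | k. 2 * k \<le> K \<and> 0 < w k}"

definition B :: "nat \<Rightarrow> real" where
  "B K = (if even K then (real K - sqrt (3 * real K - 2)) / 2
          else (real K - sqrt (3 * real K)) / 2)"

end

theory Submission imports Defs begin

text \<open>Every entry of the regression vector is \<open>\<plusminus>1\<close>, so every information matrix is a Gram matrix with
  unit diagonal. Hadamard's inequality bounds its determinant by \<open>1\<close>, the determinant of the identity
  matrix.\<close>

text \<open>One step of Gaussian elimination with pivot \<open>A 0 0\<close>: the matrix factors as
  \<open>L * U\<close>, where \<open>L\<close> is unit lower triangular and \<open>U\<close> has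
  nothing below the pivot in its first column.\<close>

lemma det_schur_complement:
  fixes A :: "nat \<Rightarrow> nat \<Rightarrow> 'a :: field"
  assumes "A 0 0 \<noteq> 0"
  shows "Determinant.det (mat (Suc n) (Suc n) (\<lambda>(i, j). A i j)) =
    A 0 0 * Determinant.det (mat n n (\<lambda>(i, j). A (Suc i) (Suc j) - A (Suc i) 0 * A 0 (Suc j) / A 0 0))"
proof -
  define L where "L = mat (Suc n) (Suc n)
    (\<lambda>(i, j). if i = j then 1 else if j = 0 then A i 0 / A 0 0 else 0)"
  define U where "U = mat (Suc n) (Suc n)
    (\<lambda>(i, j). if i = 0 then A 0 j else A i j - A i 0 * A 0 j / A 0 0)"
  have carrier: "L \<in> carrier_mat (Suc n) (Suc n)" "U \<in> carrier_mat (Suc n) (Suc n)"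
    by (auto simp: L_def U_def)
  have "mat (Suc n) (Suc n) (\<lambda>(i, j). A i j) = L * U"
  proof (rule eq_matI)
    fix i j assume "i < dim_row (L * U)" "j < dim_col (L * U)"
    then have ij: "i < Suc n" "j < Suc n"
      using carrier by auto
    then have "(L * U) $$ (i, j) = (\<Sum>k<Suc n. L $$ (i, k) * U $$ (k, j))"
      using carrier by (simp add: scalar_prod_def lessThan_atLeast0)
    also have "\<dots> = L $$ (i, 0) * U $$ (0, j) + (\<Sum>k<n. L $$ (i, Suc k) * U $$ (Suc k, j))"
      by (rule sum.lessThan_Suc_shift)
    \<comment> \<open>Apart from column 0, the columns of \<open>L\<close> are unit vectors, so at
      most one summand survives.\<close>
    also have "(\<Sum>k<n. L $$ (i, Suc k) * U $$ (Suc k, j)) =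
        (\<Sum>k<n. if i = Suc k then U $$ (i, j) else 0)"
      using ij by (intro sum.cong) (auto simp: L_def)
    also have "L $$ (i, 0) * U $$ (0, j) + \<dots> = A i j"
      using ij assms by (cases i) (auto simp: L_def U_def)
    finally show "mat (Suc n) (Suc n) (\<lambda>(i, j). A i j) $$ (i, j) = (L * U) $$ (i, j)"
      using ij by simp
  qed (use carrier in auto)
  then have "Determinant.det (mat (Suc n) (Suc n) (\<lambda>(i, j). A i j)) =
      Determinant.det L * Determinant.det U"
    using carrier by (simp add: det_mult)
  moreover have "Determinant.det L = 1"
    by (subst det_lower_triangular[OF _ carrier(1)]) (auto simp: L_def prod_list_diag_prod)
  moreover have "Determinant.det U = (\<Sum>i<Suc n. U $$ (i, 0) * cofactor U i 0)"
    by (rule laplace_expansion_column[OF carrier(2)]) simp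
  moreover have "\<dots> = U $$ (0, 0) * cofactor U 0 0"
    using assms by (subst sum.lessThan_Suc_shift) (simp add: U_def)
  moreover have "mat_delete U 0 0 =
      mat n n (\<lambda>(i, j). A (Suc i) (Suc j) - A (Suc i) 0 * A 0 (Suc j) / A 0 0)"
    by (rule eq_matI) (auto simp: mat_delete_def U_def)
  ultimately show ?thesis
    by (simp add: cofactor_def U_def)
qed

text \<open>Orthogonalising against the first coordinate function turns the Schur complement into a
  Gram matrix for the same weights \<open>c\<close>, one size smaller. The family \<open>f\<close>
  changes in this step, so the induction on \<open>n\<close> must leave it arbitrary.\<close>

theorem hadamard_det_gram:
  fixes c :: "'b \<Rightarrow> real" and f :: "'b \<Rightarrow> nat \<Rightarrow> real"
  assumes "finite S" and c: "\<And>x. x \<in> S \<Longrightarrow> 0 \<le> c x"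
  shows "Determinant.det (mat n n (\<lambda>(i, j). \<Sum>x\<in>S. c x * (f x i * f x j))) \<le>
    (\<Prod>i<n. \<Sum>x\<in>S. c x * (f x i)\<^sup>2)"
proof (induction n arbitrary: f)
  case 0
  show ?case by simp
next
  case (Suc n)
  define G where "G i j = (\<Sum>x\<in>S. c x * (f x i * f x j))" for i j
  have nonneg: "0 \<le> (\<Sum>x\<in>S. c x * (g x)\<^sup>2)" for g
    using c by (auto intro!: sum_nonneg)
  have diag: "(\<Sum>x\<in>S. c x * (f x i)\<^sup>2) = G i i" for i
    by (simp add: G_def power2_eq_square)
  show ?case
  proof (cases "G 0 0 = 0")
    case True
    \<comment> \<open>A coordinate function of norm zero vanishes wherever \<open>c\<close> is
      nonzero, so all of column 0 is zero.\<close>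
    then have "\<forall>x\<in>S. c x * (f x 0)\<^sup>2 = 0"
      using c \<open>finite S\<close> by (subst sum_nonneg_eq_0_iff[symmetric]) (auto simp: diag)
    then have zero: "G i 0 = 0" for i
      unfolding G_def by (intro sum.neutral) auto
    have "Determinant.det (mat (Suc n) (Suc n) (\<lambda>(i, j). G i j)) = 0"
      by (subst laplace_expansion_column[of _ "Suc n" 0]) (auto simp: zero)
    moreover have "0 \<le> (\<Prod>i<Suc n. \<Sum>x\<in>S. c x * (f x i)\<^sup>2)"
      by (intro prod_nonneg) (simp add: nonneg)
    ultimately show ?thesis
      unfolding G_def by simp
  next
    case False
    have pos: "0 < G 0 0"
      using False nonneg[of "\<lambda>x. f x 0"] by (simp add: diag)
    \<comment> \<open>One Gram--Schmidt step: \<open>g\<close> is the component orthogonal to the \<open>0\<close>-th coordinate function.\<close>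
    define g where "g x i = f x (Suc i) - G 0 (Suc i) / G 0 0 * f x 0" for x i
    have G_commute: "G i j = G j i" for i j
      by (simp add: G_def mult.commute)
    have gram: "(\<Sum>x\<in>S. c x * (g x i * g x j)) = G (Suc i) (Suc j) - G (Suc i) 0 * G 0 (Suc j) / G 0 0"
      for i j
    proof -
      \<comment> \<open>These are the projection coefficients of the two functions; after bilinear
        expansion the terms with \<open>a\<close> cancel.\<close>
      define a b where "a = G 0 (Suc i) / G 0 0" and "b = G 0 (Suc j) / G 0 0"
      have "(\<Sum>x\<in>S. c x * (g x i * g x j)) =
          G (Suc i) (Suc j) - b * G (Suc i) 0 - a * G 0 (Suc j) + a * b * G 0 0"
        unfolding g_def a_def[symmetric] b_def[symmetric] unfolding G_def
        by (simp add: algebra_simps sum.distrib sum_subtractf sum_distrib_left)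
      also have "a * b * G 0 0 = a * G 0 (Suc j)"
        using False by (simp add: b_def)
      finally show ?thesis
        by (simp add: b_def mult.commute)
    qed
    have "Determinant.det (mat (Suc n) (Suc n) (\<lambda>(i, j). G i j)) =
        G 0 0 * Determinant.det (mat n n (\<lambda>(i, j). \<Sum>x\<in>S. c x * (g x i * g x j)))"
      by (simp add: det_schur_complement[of G, OF False] gram)
    also have "\<dots> \<le> G 0 0 * (\<Prod>i<n. \<Sum>x\<in>S. c x * (g x i)\<^sup>2)"
      using Suc.IH[of g] pos by (intro mult_left_mono) auto
    \<comment> \<open>Projection does not increase norms: by \<open>gram\<close>, each diagonal
      entry drops by a square divided by the positive pivot.\<close>
    also have "(\<Prod>i<n. \<Sum>x\<in>S. c x * (g x i)\<^sup>2) \<le> (\<Prod>i<n. G (Suc i) (Suc i))"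
    proof (intro prod_mono conjI nonneg)
      fix i
      have "0 \<le> G 0 (Suc i) * G 0 (Suc i) / G 0 0"
        using pos by simp
      then show "(\<Sum>x\<in>S. c x * (g x i)\<^sup>2) \<le> G (Suc i) (Suc i)"
        using gram[of i i] by (simp add: power2_eq_square G_commute[of "Suc i" 0])
    qed
    also have "G 0 0 * (\<Prod>i<n. G (Suc i) (Suc i)) = (\<Prod>i<Suc n. G i i)"
      by (rule prod.lessThan_Suc_shift[symmetric])
    finally show ?thesis
      using pos unfolding diag by (simp add: G_def)
  qed
qed

lemma regression_square:
  assumes "x \<in> cube K" "i < num_params K"
  shows "(regression K x $ i)\<^sup>2 = 1"
proof -
  \<comment> \<open>Membership in the list suffices, which avoids computing the position of each
    pair \<open>j < k\<close>.\<close>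
  define xs where "xs = [1] @ [x $ k. k \<leftarrow> [0..<K]] @ [x $ j * x $ k. j \<leftarrow> [0..<K], k \<leftarrow> [Suc j..<K]]"
  have reg: "regression K x = vec_of_list xs"
    by (simp add: regression_def xs_def)
  have "length xs = num_params K"
    using dim_regression[of K x] by (simp add: reg)
  then have "regression K x $ i \<in> set xs"
    using assms(2) by (simp add: reg vec_of_list_index)
  moreover have "(x $ k)\<^sup>2 = 1" if "k < K" for k
    using assms(1) that by (auto simp: cube_def)
  then have "y\<^sup>2 = 1" if "y \<in> set xs" for y
    using that by (auto simp: xs_def power_mult_distrib)
  ultimately show ?thesis
    by blast
qed

lemma det_info_mat_le_1:
  assumes "set_pmf \<eta> \<subseteq> cube K"
  shows "Determinant.det (info_mat K \<eta>) \<le> 1"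
proof -
  have "Determinant.det (info_mat K \<eta>) \<le>
      (\<Prod>i<num_params K. \<Sum>x\<in>cube K. pmf \<eta> x * (regression K x $ i)\<^sup>2)"
    unfolding info_mat_def by (rule hadamard_det_gram) (auto simp: finite_cube)
  \<comment> \<open>Since the squared entries are 1, each diagonal entry is the total mass of the
    design.\<close>
  also have "\<dots> = (\<Prod>i<num_params K. \<Sum>x\<in>cube K. pmf \<eta> x)"
    by (intro prod.cong sum.cong) (auto simp: regression_square)
  also have "\<dots> = 1"
    using sum_pmf_eq_1[OF finite_cube assms] by simp
  finally show ?thesis .
qed

theorem corollary1:
  fixes K L :: nat and w :: "nat \<Rightarrow> real" and \<xi> :: "real vec pmf"
  assumes "2 \<le> K"
    and "real L \<le> B K"
    and "symmetric_invariant K w \<xi>"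
    and "design_on K (region K L (K - L)) \<xi>"
    and "card (supporting_orbits K w) \<le> 3"
    and "\<forall>Q \<in> supporting_orbits K w. Q \<subseteq> region K L (K - L)"
    and "info_mat K \<xi> = 1\<^sub>m (num_params K)"
  shows "D_optimal_on K (region K L (K - L)) \<xi>"
  \<comment> \<open>The determinant of \<open>\<xi>\<close> becomes 1, and every competitor is
    supported in the cube, where the bound 1 applies.\<close>
  using assms(4,7) by (auto simp: D_optimal_on_def design_on_def intro!: det_info_mat_le_1)

end
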